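(* Let $\mathbf{s}=(s_1,s_2,\ldots,s_d)$ and $\mathbf{t}=(t_1,t_2,\ldots,t_e)$ be sequences of positive integers such that $\mathbf{P}_d^{(\mathbf{s})}$ and $\mathbf{P}_e^{(\mathbf{t})}$ are IDP. Then $\mathbf{P}_{d+e+1}^{(\mathbf{s},1,\mathbf{t})}$ is IDP, where $(\mathbf{s},1,\mathbf{t})=(s_1,\ldots,s_d,1,t_1,\ldots,t_e)$.
   Context: For a sequence of positive integers $\mathbf{s}=(s_1,\ldots,s_d)$, the $\mathbf{s}$-lecture hall polytope is $\mathbf{P}_d^{(\mathbf{s})}=\{\mathbf{x}\in\mathbb{R}^d : 0\le \frac{x_1}{s_1}\le\frac{x_2}{s_2}\le\cdots\le\frac{x_d}{s_d}\le 1\}$, a $d$-dimensional lattice polytope. A lattice polytope $\mathcal{P}\subset\mathbb{R}^d$ is IDP (satisfies the integer decomposition property) if for every positive integer $k$ and every $\mathbf{z}\in k\mathcal{P}\cap\mathbb{Z}^d$ there exist $\mathbf{x}_1,\ldots,\mathbf{x}_k\in\mathcal{P}\cap\mathbb{Z}^d$ with $\mathbf{x}_1+\cdots+\mathbf{x}_k=\mathbf{z}$, where $k\mathcal{P}=\{k\alpha:\alpha\in\mathcal{P}\}$. *)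

theory Defs
  imports Complex_Main "Jordan_Normal_Form.Matrix"
begin

text \<open>Points of \<open>\<real>\<^sup>n\<close> are the vectors in \<^term>\<open>carrier_vec n\<close>, with coordinates indexed from 0.
  A sequence \<open>(s\<^sub>1, \<dots>, s\<^sub>d)\<close> is a list of length \<open>d\<close>, so \<open>s\<^sub>i\<close> is \<open>s ! (i - 1)\<close>.\<close>

text \<open>The chain \<open>0 \<le> x\<^sub>1 / s\<^sub>1 \<le> \<dots> \<le> x\<^sub>d / s\<^sub>d \<le> 1\<close> says that the list of its terms is sorted.\<close>

definition lecture_hall_polytope :: "nat list \<Rightarrow> real vec set" where
  "lecture_hall_polytope s =
     {x \<in> carrier_vec (length s).
        sorted (0 # map (\<lambda>i. x $ i / real (s ! i)) [0..<length s] @ [1])}"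

definition lattice_points :: "nat \<Rightarrow> real vec set" where
  "lattice_points n = {x \<in> carrier_vec n. \<forall>i<n. x $ i \<in> \<int>}"

definition dilate :: "nat \<Rightarrow> real vec set \<Rightarrow> real vec set" where
  "dilate k P = (\<lambda>a. real k \<cdot>\<^sub>v a) ` P"

text \<open>The integer decomposition property of \<open>P \<subseteq> \<real>\<^sup>n\<close>. It is meant for lattice polytopes \<open>P\<close>;
  lecture hall polytopes of sequences of positive integers always are lattice polytopes, so this
  is not repeated as a conjunct.\<close>

definition is_IDP :: "nat \<Rightarrow> real vec set \<Rightarrow> bool" where
  "is_IDP n P \<longleftrightarrow>
     (\<forall>k>0. \<forall>z \<in> dilate k P \<inter> lattice_points n.
        \<exists>x :: nat \<Rightarrow> real vec.
          (\<forall>j\<in>{1..k}. x j \<in> P \<inter> lattice_points n) \<and>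
          finsum_vec TYPE(real) n x {1..k} = z)"

end

theory Submission
  imports Defs
begin

text \<open>A lattice point of \<open>k P\<close> for \<open>P = P\<^bsup>(s,1,t)\<^esup>\<close> has the form \<open>(u, m, w)\<close> with \<open>m\<close> an integer in
  \<open>{0..k}\<close>, where \<open>u\<close> lies in \<open>m P\<^bsup>(s)\<^esup>\<close> and \<open>w - m t\<close> in \<open>(k - m) P\<^bsup>(t)\<^esup>\<close>. Decompose these into
  lattice points \<open>x\<^sub>1 + \<dots> + x\<^sub>m\<close> and \<open>y\<^sub>1 + \<dots> + y\<^bsub>k-m\<^esub>\<close>. Then \<open>(u, m, w)\<close> is the sum of the \<open>m\<close>
  points \<open>(x\<^sub>j, 1, t)\<close> and the \<open>k - m\<close> points \<open>(0, 0, y\<^sub>j)\<close>, all of them lattice points of \<open>P\<close>.\<close>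

text \<open>The chain without its end bounds. Keeping 0 and 1 outside lets the same list serve for
  the dilates, where only the upper bound becomes \<open>k\<close>, and lets chains be concatenated
  block by block.\<close>

definition ratios :: "nat list \<Rightarrow> real vec \<Rightarrow> real list" where
  "ratios s x = map (\<lambda>i. x $ i / real (s ! i)) [0..<length s]"

lemma length_ratios [simp]: "length (ratios s x) = length s"
  by (simp add: ratios_def)

lemma nth_ratios [simp]: "i < length s \<Longrightarrow> ratios s x ! i = x $ i / real (s ! i)"
  by (simp add: ratios_def)

lemma mem_lecture_hall_polytope:
  "x \<in> lecture_hall_polytope s \<longleftrightarrow>
     x \<in> carrier_vec (length s) \<and> sorted (0 # ratios s x @ [1])"
  by (simp add: lecture_hall_polytope_def ratios_def)

lemma ratios_smult:
  assumes "x \<in> carrier_vec (length s)"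
  shows "ratios s (c \<cdot>\<^sub>v x) = map ((*) c) (ratios s x)"
  using assms by (intro nth_equalityI) auto

lemma ratios_append:
  assumes "x \<in> carrier_vec (length s)" "y \<in> carrier_vec (length t)"
  shows "ratios (s @ t) (x @\<^sub>v y) = ratios s x @ ratios t y"
  using assms by (intro nth_equalityI) (auto simp: nth_append)

lemma ratios_Cons:
  assumes "y \<in> carrier_vec (length t)"
  shows "ratios (a # t) (vCons c y) = c / real a # ratios t y"
  using assms by (intro nth_equalityI) (auto simp: nth_Cons vec_index_vCons split: nat.split)

lemma ratios_zero: "ratios s (0\<^sub>v (length s)) = replicate (length s) 0"
  by (intro nth_equalityI) auto

lemma ratios_self:
  assumes "\<forall>a\<in>set s. 0 < a"
  shows "ratios s (map_vec real (vec_of_list s)) = replicate (length s) 1"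
  using assms by (intro nth_equalityI) (force simp: vec_of_list_index)+

text \<open>Each ratio of the vector \<open>s\<close> itself is 1, so subtracting \<open>c\<close>
  times that vector lowers every ratio by exactly \<open>c\<close>. This brings a chain that starts
  at \<open>c\<close> down to one that starts at 0.\<close>

lemma ratios_shift:
  assumes "\<forall>a\<in>set s. 0 < a" "x \<in> carrier_vec (length s)"
  shows "ratios s (x - c \<cdot>\<^sub>v map_vec real (vec_of_list s)) = map (\<lambda>r. r - c) (ratios s x)"
  using assms by (intro nth_equalityI) (force simp: vec_of_list_index diff_divide_distrib)+

lemma sorted_map_mult:
  fixes c :: real
  assumes "0 < c"
  shows "sorted (map ((*) c) xs) \<longleftrightarrow> sorted xs"
  using assms by (induction xs) auto

text \<open>Scaling by \<open>k > 0\<close> preserves and reflects order and carries the end bounds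
  0 and 1 to 0 and \<open>k\<close>; the preimage of \<open>z\<close> is \<open>z\<close> divided by
  \<open>k\<close>.\<close>

lemma mem_dilate_lecture_hall_polytope:
  assumes "0 < k"
  shows "z \<in> dilate k (lecture_hall_polytope s) \<longleftrightarrow>
     z \<in> carrier_vec (length s) \<and> sorted (0 # ratios s z @ [real k])"
proof -
  have scale: "sorted (0 # ratios s (real k \<cdot>\<^sub>v x) @ [real k]) \<longleftrightarrow> sorted (0 # ratios s x @ [1])"
    if "x \<in> carrier_vec (length s)" for x
    using sorted_map_mult[of "real k" "0 # ratios s x @ [1]"] assms that
    by (simp add: ratios_smult)
  show ?thesis
  proof
    assume "z \<in> dilate k (lecture_hall_polytope s)"
    then show "z \<in> carrier_vec (length s) \<and> sorted (0 # ratios s z @ [real k])"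
      using scale by (auto simp only: dilate_def mem_lecture_hall_polytope smult_carrier_vec)
  next
    assume z: "z \<in> carrier_vec (length s) \<and> sorted (0 # ratios s z @ [real k])"
    define x where "x = (1 / real k) \<cdot>\<^sub>v z"
    have x: "x \<in> carrier_vec (length s)" "z = real k \<cdot>\<^sub>v x"
      using z assms by (auto simp: x_def smult_smult_assoc)
    then have "x \<in> lecture_hall_polytope s"
      using scale z by (simp only: mem_lecture_hall_polytope)
    with x show "z \<in> dilate k (lecture_hall_polytope s)"
      by (auto simp: dilate_def)
  qed
qed

text \<open>Extends the decomposition to \<open>k = 0\<close>, which \<open>is_IDP\<close> leaves
  out: either of the two blocks may receive no summands. The sum is stated coordinatewise, since the
  blocks are later glued by coordinates.\<close>

lemma is_IDP_lecture_hall_polytopeD: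
  assumes idp: "is_IDP (length s) (lecture_hall_polytope s)"
    and pos: "\<forall>a\<in>set s. 0 < a"
    and z: "z \<in> lattice_points (length s)" "sorted (0 # ratios s z @ [real k])"
  obtains x where "\<And>j. j \<in> {1..k} \<Longrightarrow> x j \<in> lecture_hall_polytope s \<inter> lattice_points (length s)"
    and "\<And>i. i < length s \<Longrightarrow> (\<Sum>j=1..k. x j $ i) = z $ i"
proof (cases "k = 0")
  case True
  \<comment> \<open>The chain now runs from 0 to 0, so every ratio vanishes. As the entries of
    \<open>s\<close> are positive, \<open>z\<close> is zero, the value of the empty sum.\<close>
  have "z $ i = 0" if "i < length s" for i
  proof -
    have "z $ i / real (s ! i) \<in> set (ratios s z)"
      using that by (auto simp: ratios_def)
    then have "z $ i / real (s ! i) = 0"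
      using z(2) True by (force simp: sorted_append)
    with pos that show ?thesis by (auto simp: all_set_conv_all_nth)
  qed
  with True that show thesis by simp
next
  case False
  with z have "z \<in> dilate k (lecture_hall_polytope s) \<inter> lattice_points (length s)"
    by (simp only: mem_dilate_lecture_hall_polytope Int_iff) (simp add: lattice_points_def)
  with idp False obtain x where
    x: "\<forall>j\<in>{1..k}. x j \<in> lecture_hall_polytope s \<inter> lattice_points (length s)"
    and sum: "finsum_vec TYPE(real) (length s) x {1..k} = z"
    unfolding is_IDP_def by blast
  have "x \<in> {1..k} \<rightarrow> carrier_vec (length s)"
    using x by (auto simp: lattice_points_def)
  then have "(\<Sum>j=1..k. x j $ i) = z $ i" if "i < length s" for i
    using that sum index_finsum_vec[of "{1..k}" i "length s" x] by simp
  with x that show thesis by blast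
qed

lemma lattice_points_append:
  assumes "x \<in> carrier_vec m" "y \<in> carrier_vec n"
  shows "x @\<^sub>v y \<in> lattice_points (m + n) \<longleftrightarrow> x \<in> lattice_points m \<and> y \<in> lattice_points n"
proof
  assume lat: "x @\<^sub>v y \<in> lattice_points (m + n)"
  have "x $ i \<in> \<int>" if "i < m" for i
    using lat that assms index_append_vec(1)[of i x y]
    by (auto simp: lattice_points_def dest: spec[of _ i])
  moreover have "y $ i \<in> \<int>" if "i < n" for i
    using lat that assms index_append_vec(1)[of "m + i" x y]
    by (auto simp: lattice_points_def dest: spec[of _ "m + i"])
  ultimately show "x \<in> lattice_points m \<and> y \<in> lattice_points n"
    using assms by (auto simp: lattice_points_def)
qed (use assms in \<open>auto simp: lattice_points_def\<close>)

lemma lattice_points_vCons: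
  "vCons c y \<in> lattice_points (Suc n) \<longleftrightarrow> c \<in> \<int> \<and> y \<in> lattice_points n"
  by (auto simp: lattice_points_def All_less_Suc2)

text \<open>For joining a decomposition into \<open>m\<close> points and one into
  \<open>k - m\<close> points in a single family. The truncated subtraction \<open>j - m\<close> is
  evaluated only for \<open>j > m\<close>, where it is exact.\<close>

lemma sum_if_le_split:
  fixes f g :: "nat \<Rightarrow> 'a::comm_monoid_add"
  assumes "m \<le> k"
  shows "(\<Sum>j=1..k. if j \<le> m then f j else g (j - m)) = (\<Sum>j=1..m. f j) + (\<Sum>j=1..k-m. g j)"
proof -
  define h where "h j = (if j \<le> m then f j else g (j - m))" for j
  have "sum h {1..k} = sum h {1..m} + sum h {m+1..m+(k-m)}"
    using sum.ub_add_nat[of 1 m h "k - m"] assms by simp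
  also have "sum h {1..m} = sum f {1..m}"
    by (simp add: h_def)
  also have "sum h {m+1..m+(k-m)} = sum g {1..k-m}"
    by (rule sum.reindex_bij_witness[of _ "\<lambda>j. j + m" "\<lambda>j. j - m"]) (auto simp: h_def)
  finally show ?thesis by (simp add: h_def)
qed

theorem theorem4p5:
  fixes s t :: "nat list"
  assumes "\<forall>a\<in>set s. 0 < a"
    and "\<forall>a\<in>set t. 0 < a"
    and "is_IDP (length s) (lecture_hall_polytope s)"
    and "is_IDP (length t) (lecture_hall_polytope t)"
  shows "is_IDP (length s + length t + 1) (lecture_hall_polytope (s @ [1] @ t))"
  unfolding is_IDP_def
proof (intro allI impI ballI)
  let ?d = "length s" and ?e = "length t"
  let ?n = "?d + ?e + 1" and ?t = "map_vec real (vec_of_list t)"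
  fix k :: nat and z :: "real vec"
  assume "0 < k"
    and z: "z \<in> dilate k (lecture_hall_polytope (s @ [1] @ t)) \<inter> lattice_points ?n"
  have t_carrier: "?t \<in> carrier_vec ?e"
    by (intro carrier_vecI) simp
  have n: "?n = ?d + Suc ?e"
    by simp
  have ratios_triple: "ratios (s @ [1] @ t) (x @\<^sub>v vCons c y) = ratios s x @ c # ratios t y"
    if "x \<in> carrier_vec ?d" "y \<in> carrier_vec ?e" for x c y
    using that by (simp add: ratios_append ratios_Cons)
  have lattice_triple: "x @\<^sub>v vCons c y \<in> lattice_points ?n \<longleftrightarrow>
      x \<in> lattice_points ?d \<and> c \<in> \<int> \<and> y \<in> lattice_points ?e"
    if "x \<in> carrier_vec ?d" "y \<in> carrier_vec ?e" for x c y
    using that unfolding n by (subst lattice_points_append) (simp_all add: lattice_points_vCons)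
  define u where "u = vec_first z ?d"
  have "z \<in> carrier_vec (?d + Suc ?e)"
    using z by (simp add: lattice_points_def)
  moreover obtain c w where cw: "vec_last z (Suc ?e) = vCons c w"
    by (cases "vec_last z (Suc ?e)") (auto dest: arg_cong[of _ _ dim_vec])
  moreover have w: "w \<in> carrier_vec ?e"
    using vec_last_carrier[of z "Suc ?e"] unfolding cw by simp
  ultimately have u: "u \<in> carrier_vec ?d" and z_eq: "z = u @\<^sub>v vCons c w"
    by (simp_all add: u_def flip: cw)
  have z_lat: "u \<in> lattice_points ?d" "c \<in> \<int>" "w \<in> lattice_points ?e"
    using z lattice_triple[OF u w] unfolding z_eq by auto
  have "sorted (0 # ratios s u @ c # ratios t w @ [real k])"
    using z \<open>0 < k\<close> mem_dilate_lecture_hall_polytope[of k z "s @ [1] @ t"]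
      ratios_triple[OF u w, of c]
    by (simp add: z_eq)
  \<comment> \<open>The chain through \<open>c\<close> is cut at \<open>c\<close>, which becomes the
    upper bound for the first block and the lower bound for the last.\<close>
  then have su: "sorted (0 # ratios s u @ [c])" and sw: "sorted (c # ratios t w @ [real k])"
    and c: "0 \<le> c" "c \<le> real k"
    by (auto simp: sorted_append)
  \<comment> \<open>Here the middle entry 1 matters: the ratio at which the chain is cut is itself a
    coordinate, hence an integer, and can serve as a dilation factor.\<close>
  from \<open>c \<in> \<int>\<close> c(1) obtain m where m: "c = real m"
    by (metis Ints_cases of_int_0_le_iff of_int_of_nat_eq zero_le_imp_eq_int)
  have "m \<le> k" using c m by simp
  \<comment> \<open>Removes in advance what the \<open>m\<close> points with last block
    \<open>t\<close> will contribute.\<close>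
  define v where "v = w - c \<cdot>\<^sub>v ?t"
  have sv: "sorted (0 # ratios t v @ [real (k - m)])"
  proof -
    have "0 # ratios t v @ [real (k - m)] = map (\<lambda>r. r - c) (c # ratios t w @ [real k])"
      using assms(2) w \<open>m \<le> k\<close> by (simp add: v_def m ratios_shift of_nat_diff)
    moreover have "sorted (map (\<lambda>r. r - c) (c # ratios t w @ [real k]))"
      using sw by (simp only: sorted_map) (erule sorted_wrt_mono_rel[rotated], simp)
    ultimately show ?thesis by simp
  qed
  have v_lat: "v \<in> lattice_points ?e"
    using z_lat(3) t_carrier by (auto simp: v_def m lattice_points_def vec_of_list_index)
  obtain x where x: "\<And>j. j \<in> {1..m} \<Longrightarrow> x j \<in> lecture_hall_polytope s \<inter> lattice_points ?d"
    and x_sum: "\<And>i. i < ?d \<Longrightarrow> (\<Sum>j=1..m. x j $ i) = u $ i"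
    using is_IDP_lecture_hall_polytopeD[OF assms(3,1) z_lat(1) su[unfolded m]] by blast
  obtain y where
    y: "\<And>j. j \<in> {1..k-m} \<Longrightarrow> y j \<in> lecture_hall_polytope t \<inter> lattice_points ?e"
    and y_sum: "\<And>i. i < ?e \<Longrightarrow> (\<Sum>j=1..k-m. y j $ i) = v $ i"
    using is_IDP_lecture_hall_polytopeD[OF assms(4,2) v_lat sv] by blast
  define p where
    "p j = (if j \<le> m then x j @\<^sub>v vCons 1 ?t else 0\<^sub>v ?d @\<^sub>v vCons 0 (y (j - m)))" for j
  have p: "p j \<in> lecture_hall_polytope (s @ [1] @ t) \<inter> lattice_points ?n"
    if j: "j \<in> {1..k}" for j
  proof (cases "j \<le> m")
    case True
    with x j have xj: "x j \<in> lattice_points ?d" "x j \<in> carrier_vec ?d"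
      "sorted (0 # ratios s (x j) @ [1])"
      by (auto simp: mem_lecture_hall_polytope)
    have "?t \<in> lattice_points ?e"
      using t_carrier by (auto simp: lattice_points_def vec_of_list_index)
    \<comment> \<open>After the ratios of \<open>x j\<close> the chain stays constantly at 1,
      through the middle entry and all of \<open>t\<close>.\<close>
    with xj t_carrier True show ?thesis
      using lattice_triple[OF xj(2) t_carrier, of 1] ratios_triple[OF xj(2) t_carrier, of 1]
      by (auto simp: p_def mem_lecture_hall_polytope ratios_self[OF assms(2)] sorted_append
          lattice_points_def)
  next
    case False
    with j have "j - m \<in> {1..k-m}"
      by auto
    from y[OF this] have yj: "y (j - m) \<in> lattice_points ?e" "y (j - m) \<in> carrier_vec ?e"
      "sorted (0 # ratios t (y (j - m)) @ [1])"
      by (auto simp: mem_lecture_hall_polytope)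
    have "0\<^sub>v ?d \<in> lattice_points ?d"
      by (auto simp: lattice_points_def)
    \<comment> \<open>The chain stays at 0 up to the middle entry and then follows that of
      \<open>y (j - m)\<close>.\<close>
    with yj False show ?thesis
      using lattice_triple[OF zero_carrier_vec yj(2), of 0]
        ratios_triple[OF zero_carrier_vec yj(2), of 0]
      by (auto simp: p_def mem_lecture_hall_polytope ratios_zero sorted_append
          lattice_points_def)
  qed
  have p_carrier: "p \<in> {1..k} \<rightarrow> carrier_vec ?n"
    using p by (auto simp: lattice_points_def)
  have "finsum_vec TYPE(real) ?n p {1..k} = z"
  proof (rule eq_vecI)
    show "dim_vec (finsum_vec TYPE(real) ?n p {1..k}) = dim_vec z"
      using finsum_vec_closed[OF p_carrier] u w by (simp add: z_eq)
    fix i assume "i < dim_vec z"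
    then have i: "i < ?d + Suc ?e"
      using u w by (simp add: z_eq)
    have x_dim: "dim_vec (x j) = ?d" if "j \<in> {1..m}" for j
      using x[OF that] by (auto simp: lattice_points_def)
    have y_dim: "dim_vec (y j) = ?e" if "j \<in> {1..k-m}" for j
      using y[OF that] by (auto simp: lattice_points_def)
    have "(\<Sum>j=1..k. p j $ i) =
        (\<Sum>j=1..k. if j \<le> m then (x j @\<^sub>v vCons 1 ?t) $ i
                   else (0\<^sub>v ?d @\<^sub>v vCons 0 (y (j - m))) $ i)"
      by (intro sum.cong) (auto simp: p_def)
    also have "\<dots> = (\<Sum>j=1..m. (x j @\<^sub>v vCons 1 ?t) $ i) +
        (\<Sum>j=1..k-m. (0\<^sub>v ?d @\<^sub>v vCons 0 (y j)) $ i)"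
      by (rule sum_if_le_split[OF \<open>m \<le> k\<close>])
    also have "(\<Sum>j=1..m. (x j @\<^sub>v vCons 1 ?t) $ i) =
        (\<Sum>j=1..m. if i < ?d then x j $ i else vCons 1 ?t $ (i - ?d))"
      using i t_carrier x_dim by (intro sum.cong) auto
    also have "(\<Sum>j=1..k-m. (0\<^sub>v ?d @\<^sub>v vCons 0 (y j)) $ i) =
        (\<Sum>j=1..k-m. if i < ?d then 0 else vCons 0 (y j) $ (i - ?d))"
      using i y_dim by (intro sum.cong) auto
    also have "(\<Sum>j=1..m. if i < ?d then x j $ i else vCons 1 ?t $ (i - ?d)) +
        (\<Sum>j=1..k-m. if i < ?d then 0 else vCons 0 (y j) $ (i - ?d)) = z $ i"
    proof (cases "i < ?d")
      case True
      with u w show ?thesis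
        using x_sum[OF True] by (simp add: z_eq)
    next
      case False
      \<comment> \<open>The middle coordinate counts the points of the first kind, giving
        \<open>m = c\<close>. At position \<open>l\<close> of the last block, \<open>m\<close>
        copies of the entry of \<open>t\<close> plus the entry of \<open>v\<close> give that of
        \<open>w\<close>.\<close>
      show ?thesis
      proof (cases "i - ?d")
        case 0
        with False u w i show ?thesis
          by (simp add: z_eq m)
      next
        case (Suc l)
        with False u w t_carrier i show ?thesis
          using y_sum[of l] by (simp add: z_eq v_def m)
      qed
    qed
    finally show "finsum_vec TYPE(real) ?n p {1..k} $ i = z $ i"
      using index_finsum_vec[OF _ _ p_carrier, of i] i by simp
  qed
  with p show "\<exists>x. (\<forall>j\<in>{1..k}. x j \<in> lecture_hall_polytope (s @ [1] @ t) \<inter> lattice_points ?n) \<and>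
      finsum_vec TYPE(real) ?n x {1..k} = z"
    by blast
qed

end
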